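(* Let $G$ be a connected undirected graph on $N\ge 2$ nodes with positive link weights, and let $\mathcal{S}$ and $\mathcal{S}^{+}$ be its original and inverse simplices in $\mathbb{R}^{N-1}$. Let $\mathcal{V}$ be a non-empty proper subset of $\mathcal{N}=\{1,\dots,N\}$ with $V$ elements. If $a_{\mathcal{V}}$ is an altitude of $\mathcal{S}$ from the face $\mathcal{F}_{\mathcal{V}}$ to the complementary face $\mathcal{F}_{\bar{\mathcal{V}}}$, then $$\frac{a_{\mathcal{V}}}{\Vert a_{\mathcal{V}}\Vert}=\frac{c^{+}_{\bar{\mathcal{V}}}}{\Vert c^{+}_{\bar{\mathcal{V}}}\Vert}\qquad\text{and}\qquad a_{\mathcal{V}}=\frac{N-V}{\vert\partial^{+}\mathcal{V}\vert}\,c^{+}_{\bar{\mathcal{V}}}.$$ Similarly, if $a^{+}_{\mathcal{V}}$ is an altitude of $\mathcal{S}^{+}$ from the face $\mathcal{F}^{+}_{\mathcal{V}}$ to the complementary face $\mathcal{F}^{+}_{\bar{\mathcal{V}}}$, then $$a^{+}_{\mathcal{V}}=\frac{N-V}{\vert\partial\mathcal{V}\vert}\,c_{\bar{\mathcal{V}}}\qquad\text{and}\qquad \Vert a^{+}_{\mathcal{V}}\Vert^2=\frac{1}{\vert\partial\mathcal{V}\vert}.$$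
   Context: The graph $G$ has node set $\mathcal{N}=\{1,\dots,N\}$, link set $\mathcal{L}$ (links join distinct nodes) and weights $w_{ij}=w_{ji}>0$ for $(i,j)\in\mathcal{L}$ (all equal to $1$ in the unweighted case). The Laplacian $Q$ is the $N\times N$ symmetric matrix with $(Q)_{ii}=d_i$, the sum of the weights of links incident to $i$, $(Q)_{ij}=-w_{ij}$ if $(i,j)\in\mathcal{L}$, and $(Q)_{ij}=0$ otherwise. Since $G$ is connected, $Q$ has eigenvalues $\mu_1\ge\dots\ge\mu_{N-1}>\mu_N=0$ with orthonormal eigenvectors $z_1,\dots,z_{N}$, $z_N=u/\sqrt N$, $u$ the all-one vector; $Q^{\dagger}=\sum_{k=1}^{N-1}\frac1{\mu_k}z_kz_k^T$ is the pseudoinverse. Fix such an eigenbasis. The original simplex $\mathcal{S}$ of $G$ is the convex hull of the vertices $s_1,\dots,s_N\in\mathbb{R}^{N-1}$ with $(s_i)_k=(z_k)_i\sqrt{\mu_k}$ (so $s_i^Ts_j=(Q)_{ij}$), and the inverse simplex $\mathcal{S}^{+}$ is the convex hull of the vertices $s^{+}_1,\dots,s^{+}_N$ with $(s^{+}_i)_k=(z_k)_i/\sqrt{\mu_k}$ (so $s_i^{+T}s^{+}_j=(Q^{\dagger})_{ij}$). For $\emptyset\ne\mathcal{V}\subsetneq\mathcal{N}$ with $V$ elements, $\bar{\mathcal{V}}=\mathcal{N}\setminus\mathcal{V}$ and the face $\mathcal{F}_{\mathcal{V}}$ (resp. $\mathcal{F}^{+}_{\mathcal{V}}$) is the convex hull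 of $\{s_i\}_{i\in\mathcal{V}}$ (resp. $\{s^{+}_i\}_{i\in\mathcal{V}}$). Its centroid vector is $c_{\mathcal{V}}=\frac1V\sum_{i\in\mathcal{V}}s_i$ (resp. $c^{+}_{\mathcal{V}}=\frac1V\sum_{i\in\mathcal{V}}s^{+}_i$). An altitude $a_{\mathcal{V}}$ of $\mathcal{S}$ is a vector $a_{\mathcal{V}}=p^{\star}-q^{\star}$ with $p^{\star}\in\mathcal{F}_{\bar{\mathcal{V}}}$ and $q^{\star}\in\mathcal{F}_{\mathcal{V}}$ which is orthogonal to both faces, i.e. orthogonal to $p-p'$ for all $p,p'\in\mathcal{F}_{\mathcal{V}}$ and for all $p,p'\in\mathcal{F}_{\bar{\mathcal{V}}}$; an altitude $a^{+}_{\mathcal{V}}$ of $\mathcal{S}^{+}$ is defined in the same way with $\mathcal{F}^{+}_{\mathcal{V}},\mathcal{F}^{+}_{\bar{\mathcal{V}}}$. The cut size $\vert\partial\mathcal{V}\vert$ is the total weight (number, in the unweighted case) of links with one endpoint in $\mathcal{V}$ and the other in $\bar{\mathcal{V}}$; $\vert\partial^{+}\mathcal{V}\vert:=u_{\mathcal{V}}^TQ^{\dagger}u_{\mathcal{V}}$, where $u_{\mathcal{V}}\in\{0,1\}^N$ is the indicator vector of $\mathcal{V}$. *)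

theory Defs
  imports "HOL-Analysis.Analysis"
begin

text \<open>
  The nodes are the elements of a finite type \<open>'n\<close>, so \<open>N = CARD('n)\<close>. The coordinates of
  (N - 1)-dimensional space are indexed by a finite linearly ordered type \<open>'m\<close> with \<open>CARD('n) = CARD('m) + 1\<close>,
  playing the role of \<open>{1, \<dots>, N - 1}\<close>; in particular \<open>N \<ge> 2\<close>. The complement of a set of nodes is \<open>- V\<close>.
\<close>

text \<open>An undirected link is represented by both of its orientations in \<open>L\<close>.\<close>

definition weighted_graph :: "('n \<times> 'n) set \<Rightarrow> ('n \<Rightarrow> 'n \<Rightarrow> real) \<Rightarrow> bool" where
  "weighted_graph L w \<longleftrightarrow>
     sym L \<and> irrefl L \<and> (\<forall>i j. (i, j) \<in> L \<longrightarrow> w i j = w j i \<and> w i j > 0)"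

definition connected_graph :: "('n \<times> 'n) set \<Rightarrow> bool" where
  "connected_graph L \<longleftrightarrow> (\<forall>i j. (i, j) \<in> L\<^sup>*)"

definition node_degree :: "('n::finite \<times> 'n) set \<Rightarrow> ('n \<Rightarrow> 'n \<Rightarrow> real) \<Rightarrow> 'n \<Rightarrow> real" where
  "node_degree L w i = (\<Sum>j | (i, j) \<in> L. w i j)"

definition laplacian :: "('n::finite \<times> 'n) set \<Rightarrow> ('n \<Rightarrow> 'n \<Rightarrow> real) \<Rightarrow> real^'n^'n" where
  "laplacian L w =
     (\<chi> i j. if i = j then node_degree L w i else if (i, j) \<in> L then - w i j else 0)"

text \<open>The eigenvector \<open>z\<^sub>N = u / \<surd>N\<close> for the eigenvalue \<open>\<mu>\<^sub>N = 0\<close>.\<close>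

definition z_last :: "real^'n" where
  "z_last = (\<chi> i. 1 / sqrt (real CARD('n)))"

text \<open>
  Together with \<open>z_last\<close>, the \<open>z k\<close> form an orthonormal eigenbasis of \<open>Q\<close>, with eigenvalues
  \<open>\<mu> k\<close> in decreasing order. Positivity of the \<open>\<mu> k\<close> is not required, since it follows when \<open>Q\<close> is
  the Laplacian of a connected graph with positive weights.
\<close>

definition eigenbasis :: "real^'n^'n \<Rightarrow> ('m::linorder \<Rightarrow> real) \<Rightarrow> ('m \<Rightarrow> real^'n) \<Rightarrow> bool" where
  "eigenbasis Q \<mu> z \<longleftrightarrow>
     antimono \<mu> \<and>
     (\<forall>k. Q *v z k = \<mu> k *\<^sub>R z k) \<and>
     (\<forall>k. norm (z k) = 1) \<and>
     (\<forall>k l. k \<noteq> l \<longrightarrow> orthogonal (z k) (z l)) \<and>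
     (\<forall>k. orthogonal (z k) z_last)"

definition pseudoinverse :: "('m::finite \<Rightarrow> real) \<Rightarrow> ('m \<Rightarrow> real^'n) \<Rightarrow> real^'n^'n" where
  "pseudoinverse \<mu> z = (\<chi> i j. \<Sum>k\<in>UNIV. 1 / \<mu> k * (z k $ i * z k $ j))"

definition simplex_vertex :: "('m::finite \<Rightarrow> real) \<Rightarrow> ('m \<Rightarrow> real^'n) \<Rightarrow> 'n \<Rightarrow> real^'m" where
  "simplex_vertex \<mu> z i = (\<chi> k. z k $ i * sqrt (\<mu> k))"

definition inverse_vertex :: "('m::finite \<Rightarrow> real) \<Rightarrow> ('m \<Rightarrow> real^'n) \<Rightarrow> 'n \<Rightarrow> real^'m" where
  "inverse_vertex \<mu> z i = (\<chi> k. z k $ i / sqrt (\<mu> k))"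

text \<open>In the following three definitions \<open>s\<close> is the family of vertices of a simplex.\<close>

definition face :: "('n \<Rightarrow> real^'m) \<Rightarrow> 'n set \<Rightarrow> (real^'m) set" where
  "face s V = convex hull (s ` V)"

definition centroid :: "('n \<Rightarrow> real^'m) \<Rightarrow> 'n set \<Rightarrow> real^'m" where
  "centroid s V = (1 / real (card V)) *\<^sub>R (\<Sum>i\<in>V. s i)"

definition is_altitude :: "('n \<Rightarrow> real^'m) \<Rightarrow> 'n set \<Rightarrow> real^'m \<Rightarrow> bool" where
  "is_altitude s V a \<longleftrightarrow>
     (\<exists>p\<in>face s (- V). \<exists>q\<in>face s V. a = p - q) \<and>
     (\<forall>p\<in>face s V. \<forall>p'\<in>face s V. orthogonal a (p - p')) \<and>
     (\<forall>p\<in>face s (- V). \<forall>p'\<in>face s (- V). orthogonal a (p - p'))"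

text \<open>Only the orientation from \<open>V\<close> to its complement is summed, so each cut link counts once.\<close>

definition cut_size :: "('n \<times> 'n) set \<Rightarrow> ('n \<Rightarrow> 'n \<Rightarrow> real) \<Rightarrow> 'n set \<Rightarrow> real" where
  "cut_size L w V = (\<Sum>(i, j) \<in> L \<inter> (V \<times> - V). w i j)"

definition indicator_vec :: "'n set \<Rightarrow> real^'n" where
  "indicator_vec V = (\<chi> i. indicator V i)"

definition inverse_cut_size ::
    "('m::finite \<Rightarrow> real) \<Rightarrow> ('m \<Rightarrow> real^'n) \<Rightarrow> 'n set \<Rightarrow> real" where
  "inverse_cut_size \<mu> z V = indicator_vec V \<bullet> (pseudoinverse \<mu> z *v indicator_vec V)"

end

theory Submission
  imports Defs
begin

text \<open>
  The vertex families \<open>s\<close>, \<open>t\<close> of the two simplices are dual: \<open>\<Sum>\<^sub>i t\<^sub>i s\<^sub>i\<^sup>T = I\<close> and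
  \<open>s\<^sub>i\<^sup>T t\<^sub>j = \<delta>\<^sub>i\<^sub>j - 1 / N\<close>. Orthogonality to both faces makes \<open>a\<^sup>T s\<^sub>i\<close> constant on \<open>V\<close> and on its
  complement, with difference \<open>a\<^sup>T (p - q) = \<parallel>a\<parallel>\<^sup>2\<close>. Hence \<open>a = \<Sum>\<^sub>i (a\<^sup>T s\<^sub>i) t\<^sub>i = \<parallel>a\<parallel>\<^sup>2 T\<close>, where \<open>T\<close> is
  the sum of the \<open>t\<^sub>i\<close> over the complement of \<open>V\<close>. Moreover \<open>s\<^sub>i\<^sup>T T\<close> jumps by \<open>1\<close> from \<open>V\<close> to its
  complement, so \<open>a\<^sup>T T = 1\<close> and \<open>a = T / \<parallel>T\<parallel>\<^sup>2\<close>. Finally \<open>\<parallel>T\<parallel>\<^sup>2\<close> is the value at the indicator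
  vector of \<open>V\<close> of the quadratic form of \<open>Q\<close> or of its pseudoinverse.
\<close>

section \<open>Altitudes of a simplex with dual vertices\<close>

text \<open>Abstracting from the eigenvectors lets one argument serve both simplices, with the roles
  of \<open>s\<close> and \<open>t\<close> exchanged.\<close>

definition dual_vertices :: "('n::finite \<Rightarrow> real^'m) \<Rightarrow> ('n \<Rightarrow> real^'m) \<Rightarrow> bool" where
  "dual_vertices s t \<longleftrightarrow>
     (\<forall>x. (\<Sum>i\<in>UNIV. (x \<bullet> s i) *\<^sub>R t i) = x) \<and>
     (\<forall>i j. s i \<bullet> t j = (if i = j then 1 else 0) - 1 / real CARD('n)) \<and>
     sum t UNIV = 0"

text \<open>A level set of a linear functional is convex, so it contains the hull as soon as it
  contains the vertices.\<close>

lemma inner_face_eq: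
  assumes "x \<in> face s V" and "\<And>i. i \<in> V \<Longrightarrow> y \<bullet> s i = c"
  shows "y \<bullet> x = c"
proof -
  have "convex hull (s ` V) \<subseteq> {x. y \<bullet> x = c}"
    using assms(2) by (intro hull_minimal convex_hyperplane) auto
  then show ?thesis
    using assms(1) unfolding face_def by auto
qed

lemma vertex_in_face: "i \<in> V \<Longrightarrow> s i \<in> face s V"
  unfolding face_def by (simp add: hull_inc)

lemma altitude_eq_scaled_dual_sum:
  fixes s t :: "'n::finite \<Rightarrow> real^'m"
  assumes dual: "dual_vertices s t" and alt: "is_altitude s V a"
  shows "a = (norm a)\<^sup>2 *\<^sub>R sum t (- V)"
proof -
  from alt obtain p q where pq: "p \<in> face s (- V)" "q \<in> face s V" "a = p - q"
    and oV: "\<And>x y. x \<in> face s V \<Longrightarrow> y \<in> face s V \<Longrightarrow> a \<bullet> (x - y) = 0"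
    and oC: "\<And>x y. x \<in> face s (- V) \<Longrightarrow> y \<in> face s (- V) \<Longrightarrow> a \<bullet> (x - y) = 0"
    unfolding is_altitude_def orthogonal_def by blast
  have cV: "a \<bullet> s i = a \<bullet> q" if "i \<in> V" for i
    using oV[OF vertex_in_face[OF that] pq(2)] by (simp add: inner_diff_right)
  have cC: "a \<bullet> s i = a \<bullet> p" if "i \<in> - V" for i
    using oC[OF vertex_in_face[OF that] pq(1)] by (simp add: inner_diff_right)
  have split: "sum f UNIV = sum f V + sum f (- V)" for f :: "'n \<Rightarrow> real^'m"
    using sum.union_disjoint[of V "- V" f] by (simp add: Compl_partition)
  have "sum t V = - sum t (- V)"
    using dual split[of t] unfolding dual_vertices_def by (simp add: eq_neg_iff_add_eq_0)
  moreover have "a = (\<Sum>i\<in>UNIV. (a \<bullet> s i) *\<^sub>R t i)"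
    using dual unfolding dual_vertices_def by simp
  \<comment> \<open>The expansion of \<open>a\<close> splits into \<open>a \<bullet> q\<close> times
    the sum over \<open>V\<close> and \<open>a \<bullet> p\<close> times the sum over the
    complement; these two sums are opposite.\<close>
  ultimately have "a = (a \<bullet> p - a \<bullet> q) *\<^sub>R sum t (- V)"
    by (simp add: split cV cC flip: scaleR_right.sum) (simp add: algebra_simps)
  also have "a \<bullet> p - a \<bullet> q = (norm a)\<^sup>2"
    using pq(3) by (simp add: power2_norm_eq_inner flip: inner_diff_right)
  finally show ?thesis .
qed

lemma altitude_inner_dual_sum:
  fixes s t :: "'n::finite \<Rightarrow> real^'m"
  assumes dual: "dual_vertices s t" and alt: "is_altitude s V a"
  shows "sum t (- V) \<bullet> a = 1"
proof -
  \<comment> \<open>\<open>c\<close> collects the offsets \<open>1 / N\<close> over the complement;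
    it cancels in the difference \<open>p - q\<close>.\<close>
  define c where "c = real (card (- V)) / real CARD('n)"
  from alt obtain p q where pq: "p \<in> face s (- V)" "q \<in> face s V" "a = p - q"
    unfolding is_altitude_def by blast
  have inner: "sum t (- V) \<bullet> s i = (if i \<in> - V then 1 else 0) - c" for i
  proof -
    have "s i \<bullet> t j = (if i = j then 1 else 0) - 1 / real CARD('n)" for j
      using dual unfolding dual_vertices_def by blast
    then have "sum t (- V) \<bullet> s i = (\<Sum>j\<in>- V. (if i = j then 1 else 0) - 1 / real CARD('n))"
      by (subst inner_commute) (simp add: inner_sum_right)
    also have "\<dots> = (if i \<in> - V then 1 else 0) - c"
      by (simp add: sum_subtractf c_def)
    finally show ?thesis .
  qed
  have "sum t (- V) \<bullet> p = 1 - c" and "sum t (- V) \<bullet> q = - c"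
    using inner_face_eq[OF pq(1), of "sum t (- V)" "1 - c"]
      inner_face_eq[OF pq(2), of "sum t (- V)" "- c"] inner by auto
  then show ?thesis
    using pq(3) by (simp add: inner_diff_right)
qed

text \<open>The norms involve the sum over \<open>V\<close>, the negative of the sum over the
  complement, because the cut sizes are quadratic forms at the indicator vector of
  \<open>V\<close>.\<close>

lemma altitude_eq_dual_centroid:
  fixes s t :: "'n::finite \<Rightarrow> real^'m"
  assumes dual: "dual_vertices s t" and alt: "is_altitude s V a" and "V \<noteq> UNIV"
  shows "a /\<^sub>R norm a = centroid t (- V) /\<^sub>R norm (centroid t (- V))"
    and "a = ((real CARD('n) - real (card V)) / (norm (sum t V))\<^sup>2) *\<^sub>R centroid t (- V)"
    and "(norm a)\<^sup>2 = 1 / (norm (sum t V))\<^sup>2"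
proof -
  define T where "T = sum t (- V)"
  define m where "m = real CARD('n) - real (card V)"
  have card: "real (card (- V)) = m"
    unfolding m_def Compl_eq_Diff_UNIV
    by (subst card_Diff_subset) (simp_all add: of_nat_diff card_mono)
  have "- V \<noteq> {}"
    using \<open>V \<noteq> UNIV\<close> by auto
  then have "m > 0"
    unfolding card[symmetric] by (simp add: card_gt_0_iff)
  have a: "a = (norm a)\<^sup>2 *\<^sub>R T" and aT: "T \<bullet> a = 1"
    using altitude_eq_scaled_dual_sum[OF dual alt] altitude_inner_dual_sum[OF dual alt]
    by (simp_all add: T_def)
  have "T \<noteq> 0" "a \<noteq> 0"
    using aT by auto
  have "sum t V = - T"
    using dual sum.union_disjoint[of V "- V" t]
    unfolding dual_vertices_def T_def by (simp add: Compl_partition eq_neg_iff_add_eq_0)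
  then have nT: "(norm (sum t V))\<^sup>2 = (norm T)\<^sup>2"
    by simp
  have "1 = (norm a)\<^sup>2 * (norm T)\<^sup>2"
    using aT by (subst (asm) a) (simp add: power2_norm_eq_inner)
  then show norm_a: "(norm a)\<^sup>2 = 1 / (norm (sum t V))\<^sup>2"
    using \<open>T \<noteq> 0\<close> by (simp add: nT field_simps)
  have c: "centroid t (- V) = (1 / m) *\<^sub>R T"
    unfolding centroid_def card T_def by simp
  show "a = ((real CARD('n) - real (card V)) / (norm (sum t V))\<^sup>2) *\<^sub>R centroid t (- V)"
    using a \<open>m > 0\<close> by (simp add: c norm_a flip: m_def)
  \<comment> \<open>\<open>sgn\<close> ignores positive factors, and both \<open>a\<close> and the
    centroid are positive multiples of \<open>T\<close>.\<close>
  have sgn_eq: "x /\<^sub>R norm x = sgn x" for x :: "real^'m"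
    by (simp add: sgn_div_norm)
  have "sgn a = sgn T"
    using \<open>a \<noteq> 0\<close> by (subst a) (simp add: sgn_scaleR)
  then show "a /\<^sub>R norm a = centroid t (- V) /\<^sub>R norm (centroid t (- V))"
    unfolding sgn_eq using \<open>m > 0\<close> by (simp add: c sgn_scaleR)
qed

subsection \<open>The Laplacian\<close>

text \<open>Expanding the degree pairs each link's diagonal contribution with its off-diagonal one.
  Absence of loops allows the matrix entry to be split into two separate terms.\<close>

lemma laplacian_mult_component:
  assumes "irrefl L"
  shows "(laplacian L w *v x) $ i = (\<Sum>j | (i, j) \<in> L. w i j * (x $ i - x $ j))"
proof -
  have "(i, i) \<notin> L"
    using assms by (simp add: irrefl_def)
  have "(laplacian L w *v x) $ i
      = (\<Sum>j\<in>UNIV. (if i = j then node_degree L w i * x $ i else 0)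
          - (if (i, j) \<in> L then w i j * x $ j else 0))"
    unfolding laplacian_def matrix_vector_mult_def
    using \<open>(i, i) \<notin> L\<close> by (auto intro!: sum.cong)
  also have "\<dots> = node_degree L w i * x $ i - (\<Sum>j | (i, j) \<in> L. w i j * x $ j)"
    by (simp add: sum_subtractf sum.If_cases)
  finally show ?thesis
    by (simp add: node_degree_def sum_distrib_right right_diff_distrib sum_subtractf)
qed

text \<open>Reversing all links gives a second expression for the form; adding the two completes the
  square. The factor 1/2 compensates for \<open>L\<close> holding both orientations.\<close>

lemma laplacian_quadratic_form:
  assumes "weighted_graph L w"
  shows "x \<bullet> (laplacian L w *v x) = (\<Sum>(i, j)\<in>L. w i j * (x $ i - x $ j)\<^sup>2) / 2"
proof -
  have "sym L" "irrefl L" and sw: "\<And>i j. (i, j) \<in> L \<Longrightarrow> w i j = w j i"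
    using assms unfolding weighted_graph_def by auto
  have L: "(SIGMA i:UNIV. {j. (i, j) \<in> L}) = L"
    by auto
  have form: "x \<bullet> (laplacian L w *v x) = (\<Sum>(i, j)\<in>L. w i j * (x $ i - x $ j) * x $ i)"
    unfolding inner_vec_def laplacian_mult_component[OF \<open>irrefl L\<close>]
    by (simp add: sum_distrib_left sum.Sigma L mult_ac)
  also have "\<dots> = (\<Sum>(i, j)\<in>L. w j i * (x $ j - x $ i) * x $ j)"
    using \<open>sym L\<close>
    by (intro sum.reindex_bij_witness[where i = prod.swap and j = prod.swap])
      (auto dest: symD)
  also have "\<dots> = (\<Sum>(i, j)\<in>L. - (w i j * (x $ i - x $ j) * x $ j))"
  proof (intro sum.cong refl, clarify)
    fix i j
    assume "(i, j) \<in> L"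
    then show "w j i * (x $ j - x $ i) * x $ j = - (w i j * (x $ i - x $ j) * x $ j)"
      unfolding sw[OF \<open>(i, j) \<in> L\<close>] by (simp add: algebra_simps)
  qed
  finally have "2 * (x \<bullet> (laplacian L w *v x))
      = (\<Sum>(i, j)\<in>L. w i j * (x $ i - x $ j) * x $ i)
        + (\<Sum>(i, j)\<in>L. - (w i j * (x $ i - x $ j) * x $ j))"
    using form by linarith
  also have "\<dots> = (\<Sum>(i, j)\<in>L. w i j * (x $ i - x $ j)\<^sup>2)"
    unfolding sum.distrib[symmetric]
    by (intro sum.cong) (auto simp: algebra_simps power2_eq_square)
  finally show ?thesis
    by simp
qed

text \<open>The squared difference of the indicator is 1 exactly on cut links, and each of these
  occurs in both orientations, which absorbs the factor 1/2.\<close>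

lemma laplacian_quadratic_form_indicator:
  assumes "weighted_graph L w"
  shows "indicator_vec V \<bullet> (laplacian L w *v indicator_vec V) = cut_size L w V"
proof -
  have "sym L" and sw: "\<And>i j. (i, j) \<in> L \<Longrightarrow> w i j = w j i"
    using assms unfolding weighted_graph_def by auto
  have "(\<Sum>(i, j)\<in>L. w i j * (indicator_vec V $ i - indicator_vec V $ j)\<^sup>2)
      = (\<Sum>(i, j)\<in>L \<inter> (V \<times> - V) \<union> L \<inter> ((- V) \<times> V). w i j)"
    by (intro sum.mono_neutral_cong_right)
      (auto simp: indicator_vec_def indicator_def)
  also have "\<dots> = cut_size L w V + (\<Sum>(i, j)\<in>L \<inter> ((- V) \<times> V). w i j)"
    unfolding cut_size_def by (intro sum.union_disjoint) auto
  also have "(\<Sum>(i, j)\<in>L \<inter> ((- V) \<times> V). w i j) = cut_size L w V"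
    unfolding cut_size_def using \<open>sym L\<close> sw
    by (intro sum.reindex_bij_witness[where i = prod.swap and j = prod.swap])
      (auto dest: symD)
  finally show ?thesis
    unfolding laplacian_quadratic_form[OF assms] by simp
qed

text \<open>Every term of the vanishing sum is nonnegative, so \<open>x\<close> agrees across each
  link; connectedness carries the equality along paths.\<close>

lemma laplacian_kernel_constant:
  assumes graph: "weighted_graph L w" and conn: "connected_graph L"
    and zero: "x \<bullet> (laplacian L w *v x) = 0"
  shows "x $ i = x $ j"
proof -
  have pos: "\<And>i j. (i, j) \<in> L \<Longrightarrow> w i j > 0"
    using graph unfolding weighted_graph_def by auto
  have "(\<Sum>(i, j)\<in>L. w i j * (x $ i - x $ j)\<^sup>2) = 0"
    using zero unfolding laplacian_quadratic_form[OF graph] by simp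
  then have "\<forall>(i, j)\<in>L. w i j * (x $ i - x $ j)\<^sup>2 = 0"
    by (subst (asm) sum_nonneg_eq_0_iff) (auto simp: less_imp_le[OF pos])
  then have edge: "x $ i = x $ j" if "(i, j) \<in> L" for i j
    using pos[OF that] that by fastforce
  have "(i, j) \<in> L\<^sup>*"
    using conn unfolding connected_graph_def by blast
  then show ?thesis
    by (induction rule: rtrancl_induct) (auto dest: edge)
qed

text \<open>The quadratic form at the unit vector \<open>z k\<close> equals \<open>\<mu> k\<close>.
  If it vanished, \<open>z k\<close> would be constant, and orthogonality to \<open>z_last\<close>
  would make it zero.\<close>

lemma laplacian_eigenvalue_pos:
  fixes L :: "('n::finite \<times> 'n) set"
  assumes graph: "weighted_graph L w" and conn: "connected_graph L"
    and basis: "eigenbasis (laplacian L w) \<mu> z"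
  shows "\<mu> k > 0"
proof -
  have ev: "laplacian L w *v z k = \<mu> k *\<^sub>R z k" and norm: "norm (z k) = 1"
    and orth: "z k \<bullet> z_last = 0"
    using basis unfolding eigenbasis_def orthogonal_def by blast+
  have form: "z k \<bullet> (laplacian L w *v z k) = \<mu> k"
    using norm by (simp add: ev norm_eq_1)
  have "\<mu> k \<ge> 0"
    unfolding form[symmetric] laplacian_quadratic_form[OF graph]
    using graph unfolding weighted_graph_def
    by (intro divide_nonneg_nonneg sum_nonneg) (auto simp: less_imp_le)
  moreover have "\<mu> k \<noteq> 0"
  proof
    assume "\<mu> k = 0"
    then have const: "z k $ i = z k $ j" for i j
      using laplacian_kernel_constant[OF graph conn] form by simp
    have "z k $ i = 0" for i
    proof -
      have "z k \<bullet> z_last = (\<Sum>j\<in>(UNIV :: 'n set). z k $ i * (1 / sqrt (real CARD('n))))"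
        unfolding inner_vec_def z_last_def using const by (intro sum.cong) auto
      then show ?thesis
        using orth by simp
    qed
    then have "z k = 0"
      by (simp add: vec_eq_iff)
    then show False
      using norm by simp
  qed
  ultimately show ?thesis
    by simp
qed

subsection \<open>Expansions in the eigenbasis\<close>

lemma z_last_inner_self: "(z_last :: real^'n) \<bullet> z_last = 1"
  by (simp add: inner_vec_def z_last_def)

lemma laplacian_mult_z_last:
  assumes "irrefl L"
  shows "laplacian L w *v z_last = 0"
  by (simp add: vec_eq_iff laplacian_mult_component[OF assms]) (simp add: z_last_def)

lemma eigenbasis_inner:
  assumes "eigenbasis Q \<mu> z"
  shows "z k \<bullet> z l = (if k = l then 1 else 0)" and "z k \<bullet> z_last = 0"
  using assms unfolding eigenbasis_def orthogonal_def by (auto simp: norm_eq_1)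

text \<open>The vectors \<open>z k\<close> and \<open>z_last\<close> are N orthonormal vectors in
  dimension N, hence they span.\<close>

lemma eigenbasis_expansion:
  fixes z :: "'m::{finite,linorder} \<Rightarrow> real^'n"
  assumes card: "CARD('n) = CARD('m) + 1" and basis: "eigenbasis Q \<mu> z"
  shows "x = (\<Sum>k\<in>UNIV. (z k \<bullet> x) *\<^sub>R z k) + (z_last \<bullet> x) *\<^sub>R z_last"
proof -
  note inner = eigenbasis_inner[OF basis]
  define B where "B = insert z_last (range z)"
  have "inj z"
    by (rule injI) (metis inner(1) zero_neq_one)
  have "z_last \<notin> range z"
    using inner(2) z_last_inner_self by (metis rangeE zero_neq_one)
  then have "card B = CARD('n)"
    using card card_image[OF \<open>inj z\<close>] by (simp add: B_def)
  have "pairwise orthogonal B"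
    unfolding pairwise_def B_def orthogonal_def using inner by (auto simp: inner_commute)
  moreover have "0 \<notin> B"
  proof
    assume "0 \<in> B"
    then have "z_last = (0 :: real^'n) \<or> (\<exists>k. z k = 0)"
      by (auto simp: B_def)
    then show False
      using inner(1) z_last_inner_self by (metis inner_zero_left zero_neq_one)
  qed
  ultimately have "independent B"
    by (rule pairwise_orthogonal_independent)
  then have span: "span B = UNIV"
    using card_ge_dim_independent[of B UNIV] \<open>card B = CARD('n)\<close> by auto
  \<comment> \<open>The residual is orthogonal to a spanning set, hence to itself.\<close>
  define y where "y = x - ((\<Sum>k\<in>UNIV. (z k \<bullet> x) *\<^sub>R z k) + (z_last \<bullet> x) *\<^sub>R z_last)"
  have "z l \<bullet> y = 0" for l
    by (simp add: y_def inner_diff_right inner_add_right inner_sum_right inner if_distrib cong: if_cong)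
  moreover have "z_last \<bullet> z l = 0" for l
    by (subst inner_commute) (rule inner(2))
  then have "z_last \<bullet> y = 0"
    by (simp add: y_def inner_diff_right inner_add_right inner_sum_right z_last_inner_self)
  ultimately have "orthogonal y b" if "b \<in> B" for b
    using that by (auto simp: B_def orthogonal_def inner_commute)
  then have "orthogonal y y"
    by (metis orthogonal_to_span span UNIV_I)
  then show ?thesis
    by (simp add: y_def orthogonal_def)
qed

text \<open>Read off from the expansion of the \<open>j\<close>-th unit vector; \<open>1 / N\<close>
  is the contribution of \<open>z_last\<close>.\<close>

lemma eigenbasis_completeness:
  fixes z :: "'m::{finite,linorder} \<Rightarrow> real^'n"
  assumes "CARD('n) = CARD('m) + 1" and "eigenbasis Q \<mu> z"
  shows "(\<Sum>k\<in>UNIV. z k $ i * z k $ j) = (if i = j then 1 else 0) - 1 / real CARD('n)"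
proof -
  have "axis j 1 $ i = (\<Sum>k\<in>UNIV. z k $ j * z k $ i) + z_last $ j * (z_last :: real^'n) $ i"
    by (subst eigenbasis_expansion[OF assms, of "axis j 1"])
      (simp add: inner_axis)
  then show ?thesis
    by (simp add: z_last_def axis_def mult.commute eq_commute split: if_splits)
qed

section \<open>Duality of the two simplices\<close>

lemma eigenbasis_sum_components:
  fixes z :: "'m::{finite,linorder} \<Rightarrow> real^'n"
  assumes "eigenbasis Q \<mu> z"
  shows "(\<Sum>i\<in>UNIV. z k $ i) = 0"
  using eigenbasis_inner(2)[OF assms, of k]
  by (simp add: inner_vec_def z_last_def flip: sum_divide_distrib)

text \<open>Reciprocal scalings \<open>r\<close>, \<open>r'\<close> cover both orders of the two
  simplices. Orthonormality of the \<open>z k\<close> gives the reconstruction formula, completeness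
  the inner products, and orthogonality to \<open>z_last\<close> the zero sum.\<close>

lemma dual_vertices_simplex:
  fixes z :: "'m::{finite,linorder} \<Rightarrow> real^'n"
  assumes card: "CARD('n) = CARD('m) + 1" and basis: "eigenbasis Q \<mu> z"
    and scale: "\<And>k. r k * r' k = 1"
  shows "dual_vertices (\<lambda>i. \<chi> k. z k $ i * r k) (\<lambda>i. \<chi> k. z k $ i * r' k)"
  unfolding dual_vertices_def
proof (intro conjI allI)
  fix x
  show "(\<Sum>i\<in>UNIV. (x \<bullet> (\<chi> k. z k $ i * r k)) *\<^sub>R (\<chi> k. z k $ i * r' k)) = x"
    unfolding vec_eq_iff
  proof
    fix l
    have "(\<Sum>i\<in>UNIV. (x \<bullet> (\<chi> k. z k $ i * r k)) *\<^sub>R (\<chi> k. z k $ i * r' k)) $ l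
        = (\<Sum>i\<in>UNIV. \<Sum>k\<in>UNIV. x $ k * r k * r' l * (z k $ i * z l $ i))"
      by (simp add: inner_vec_def sum_distrib_left mult_ac)
    also have "\<dots> = (\<Sum>k\<in>UNIV. x $ k * r k * r' l * (z k \<bullet> z l))"
      by (subst sum.swap) (simp add: inner_vec_def sum_distrib_left)
    also have "\<dots> = x $ l"
      using scale[of l]
      by (simp add: eigenbasis_inner[OF basis] if_distrib mult.assoc cong: if_cong)
    finally show "(\<Sum>i\<in>UNIV. (x \<bullet> (\<chi> k. z k $ i * r k)) *\<^sub>R (\<chi> k. z k $ i * r' k)) $ l = x $ l" .
  qed
next
  fix i j
  have prod: "z k $ i * r k * (z k $ j * r' k) = r k * r' k * (z k $ i * z k $ j)" for k
    by (simp add: mult_ac)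
  show "(\<chi> k. z k $ i * r k) \<bullet> (\<chi> k. z k $ j * r' k)
      = (if i = j then 1 else 0) - 1 / real CARD('n)"
    unfolding eigenbasis_completeness[OF card basis, symmetric] by (simp add: inner_vec_def prod scale)
next
  show "(\<Sum>i\<in>UNIV. \<chi> k. z k $ i * r' k) = 0"
    by (simp add: vec_eq_iff eigenbasis_sum_components[OF basis] flip: sum_distrib_right)
qed

section \<open>Cut sizes as squared norms of vertex sums\<close>

lemma sum_component_eq_inner_indicator:
  fixes x :: "real^'n"
  shows "(\<Sum>i\<in>V. x $ i) = x \<bullet> indicator_vec V"
  by (simp add: inner_vec_def indicator_vec_def indicator_def if_distrib sum.If_cases cong: if_cong)

text \<open>With \<open>u\<close> the indicator vector, the coordinates of the sum are
  \<open>(z k \<bullet> u) / sqrt (\<mu> k)\<close>; their squares add up to the spectral form of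
  the pseudoinverse at \<open>u\<close>.\<close>

lemma norm_sum_inverse_vertex:
  fixes z :: "'m::{finite,linorder} \<Rightarrow> real^'n"
  assumes pos: "\<And>k. \<mu> k > 0"
  shows "(norm (sum (inverse_vertex \<mu> z) V))\<^sup>2 = inverse_cut_size \<mu> z V"
proof -
  let ?u = "indicator_vec V :: real^'n"
  have "sum (inverse_vertex \<mu> z) V $ k = (z k \<bullet> ?u) / sqrt (\<mu> k)" for k
    by (simp add: inverse_vertex_def sum_component_eq_inner_indicator flip: sum_divide_distrib)
  then have "(norm (sum (inverse_vertex \<mu> z) V))\<^sup>2 = (\<Sum>k\<in>UNIV. (z k \<bullet> ?u)\<^sup>2 / \<mu> k)"
    unfolding power2_norm_eq_inner inner_vec_def[of "sum _ _"]
    using pos by (simp add: less_imp_le power2_eq_square)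
  also have "\<dots> = (\<Sum>k\<in>UNIV. \<Sum>i\<in>UNIV. \<Sum>j\<in>UNIV. ?u $ i * (1 / \<mu> k * (z k $ i * z k $ j) * ?u $ j))"
    by (simp add: power2_eq_square inner_vec_def sum_product sum_divide_distrib mult_ac)
  also have "\<dots> = (\<Sum>i\<in>UNIV. \<Sum>j\<in>UNIV. \<Sum>k\<in>UNIV. ?u $ i * (1 / \<mu> k * (z k $ i * z k $ j) * ?u $ j))"
    by (subst sum.swap, intro sum.cong refl, subst sum.swap, rule refl)
  also have "\<dots> = inverse_cut_size \<mu> z V"
    by (simp add: inverse_cut_size_def pseudoinverse_def inner_vec_def matrix_vector_mult_def
        sum_distrib_left sum_distrib_right)
  finally show ?thesis .
qed

text \<open>Applying the Laplacian to the expansion of the indicator vector kills the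
  \<open>z_last\<close> term and scales the others by \<open>\<mu> k\<close>, so the cut size
  becomes a sum of squared coordinates.\<close>

lemma norm_sum_simplex_vertex:
  fixes z :: "'m::{finite,linorder} \<Rightarrow> real^'n"
  assumes card: "CARD('n) = CARD('m) + 1" and graph: "weighted_graph L w"
    and basis: "eigenbasis (laplacian L w) \<mu> z" and pos: "\<And>k. \<mu> k > 0"
  shows "(norm (sum (simplex_vertex \<mu> z) V))\<^sup>2 = cut_size L w V"
proof -
  let ?u = "indicator_vec V :: real^'n"
  have "irrefl L"
    using graph unfolding weighted_graph_def by simp
  have ev: "laplacian L w *v z k = \<mu> k *\<^sub>R z k" for k
    using basis unfolding eigenbasis_def by blast
  have "laplacian L w *v ?u = (\<Sum>k\<in>UNIV. (z k \<bullet> ?u) *\<^sub>R \<mu> k *\<^sub>R z k)"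
    by (subst eigenbasis_expansion[OF card basis, of ?u])
      (simp add: matrix_vector_right_distrib matrix_vector_mult_scaleR ev
        laplacian_mult_z_last[OF \<open>irrefl L\<close>] linear_sum[OF matrix_vector_mul_linear])
  then have "cut_size L w V = (\<Sum>k\<in>UNIV. \<mu> k * (z k \<bullet> ?u)\<^sup>2)"
    unfolding laplacian_quadratic_form_indicator[OF graph, symmetric]
    by (simp add: inner_sum_right power2_eq_square inner_commute mult_ac)
  moreover have "sum (simplex_vertex \<mu> z) V $ k = (z k \<bullet> ?u) * sqrt (\<mu> k)" for k
    by (simp add: simplex_vertex_def sum_component_eq_inner_indicator flip: sum_distrib_right)
  then have "(norm (sum (simplex_vertex \<mu> z) V))\<^sup>2 = (\<Sum>k\<in>UNIV. (z k \<bullet> ?u)\<^sup>2 * \<mu> k)"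
    unfolding power2_norm_eq_inner inner_vec_def[of "sum _ _"]
    using pos by (intro sum.cong) (simp_all add: less_imp_le power2_eq_square mult_ac)
  ultimately show ?thesis
    by (simp add: mult.commute)
qed

theorem mainTheorem3:
  fixes L :: "('n::finite \<times> 'n) set"
    and w :: "'n \<Rightarrow> 'n \<Rightarrow> real"
    and \<mu> :: "'m::{finite,linorder} \<Rightarrow> real"
    and z :: "'m \<Rightarrow> real^'n"
    and V :: "'n set"
  assumes "CARD('n) = CARD('m) + 1"
    and "weighted_graph L w"
    and "connected_graph L"
    and "eigenbasis (laplacian L w) \<mu> z"
    and "V \<noteq> {}" and "V \<subset> UNIV"
  shows "(\<forall>a. is_altitude (simplex_vertex \<mu> z) V a \<longrightarrow>
            a /\<^sub>R norm a =
              centroid (inverse_vertex \<mu> z) (- V) /\<^sub>R norm (centroid (inverse_vertex \<mu> z) (- V)) \<and>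
            a = ((real CARD('n) - real (card V)) / inverse_cut_size \<mu> z V) *\<^sub>R
                centroid (inverse_vertex \<mu> z) (- V)) \<and>
         (\<forall>a. is_altitude (inverse_vertex \<mu> z) V a \<longrightarrow>
            a = ((real CARD('n) - real (card V)) / cut_size L w V) *\<^sub>R
                centroid (simplex_vertex \<mu> z) (- V) \<and>
            (norm a)\<^sup>2 = 1 / cut_size L w V)"
proof -
  have pos: "\<mu> k > 0" for k
    by (rule laplacian_eigenvalue_pos[OF assms(2-4)])
  then have scale: "sqrt (\<mu> k) * (1 / sqrt (\<mu> k)) = 1" "1 / sqrt (\<mu> k) * sqrt (\<mu> k) = 1" for k
    using less_imp_neq[OF pos[of k]] by simp_all
  have "dual_vertices (simplex_vertex \<mu> z) (inverse_vertex \<mu> z)"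
    and "dual_vertices (inverse_vertex \<mu> z) (simplex_vertex \<mu> z)"
    using dual_vertices_simplex[OF assms(1,4) scale(1)] dual_vertices_simplex[OF assms(1,4) scale(2)]
    by (simp_all add: simplex_vertex_def[abs_def] inverse_vertex_def[abs_def])
  \<comment> \<open>Each order of the duality yields the altitudes of one simplex; it remains to
    rewrite the squared norms as cut sizes.\<close>
  note altitude = this[THEN altitude_eq_dual_centroid(1)] this[THEN altitude_eq_dual_centroid(2)]
    this(2)[THEN altitude_eq_dual_centroid(3)]
  show ?thesis
    using altitude assms(6)
    unfolding norm_sum_inverse_vertex[OF pos] norm_sum_simplex_vertex[OF assms(1,2,4) pos]
    by blast
qed

end
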